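(* Let $\Delta$ be a simplicial complex over $[n]$ with facets $F_1,\dots,F_r$, $r>1$, and let $I_{\mathcal{F}}(\Delta)=(m_{F_1},\dots,m_{F_r})$ be its facet ideal. A facet $F_i$ of $\Delta$ is a leaf if and only if the ideal $(\mathrm{Res}(\hat{I}_{F_i}))$ generated by the set $$\mathrm{Res}(\hat{I}_{F_i})=\left\{u_j=\frac{m_{F_i}}{\gcd(m_{F_i},m_{F_j})}\ \middle|\ j\neq i\right\}$$ is a principal ideal.
   Context: A simplicial complex $\Delta$ over $[n]=\{1,\dots,n\}$ is a collection of subsets of $[n]$ closed under taking subsets; its maximal members under inclusion are its facets. Let $S=k[x_1,\dots,x_n]$ be the polynomial ring over an infinite field $k$. For a facet $F$, $m_F=\prod_{i\in F}x_i$, and the facet ideal $I_{\mathcal{F}}(\Delta)\subset S$ is the ideal minimally generated by the monomials $m_F$ for all facets $F$ of $\Delta$. Leaf (Faridi): a facet $F$ of $\Delta$ is a leaf if either $F$ is the only facet of $\Delta$, or there exists a facet $G$ of $\Delta$, $G\neq F$, such that $F\cap F'\subseteq F\cap G$ for every facet $F'$ of $\Delta$ with $F'\neq F$. *)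

theory Defs
  imports "HOL-Algebra.Ideal" "HOL-Algebra.Divisibility" "HOL-Library.Poly_Mapping"
begin

definition simplicial_complex :: "nat \<Rightarrow> nat set set \<Rightarrow> bool" where
  "simplicial_complex n \<Delta> \<longleftrightarrow>
     \<Delta> \<subseteq> Pow {1..n} \<and> (\<forall>F\<in>\<Delta>. \<forall>G. G \<subseteq> F \<longrightarrow> G \<in> \<Delta>)"

definition facets :: "nat set set \<Rightarrow> nat set set" where
  "facets \<Delta> = {F \<in> \<Delta>. \<forall>G\<in>\<Delta>. F \<subseteq> G \<longrightarrow> G = F}"

definition leaf :: "nat set set \<Rightarrow> nat set \<Rightarrow> bool" where
  "leaf \<Delta> F \<longleftrightarrow> F \<in> facets \<Delta> \<and>
     (facets \<Delta> = {F} \<or>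
      (\<exists>G\<in>facets \<Delta>. G \<noteq> F \<and>
        (\<forall>F'\<in>facets \<Delta>. F' \<noteq> F \<longrightarrow> F \<inter> F' \<subseteq> F \<inter> G)))"

text \<open>A polynomial is a finitely supported map from exponent vectors to coefficients, an exponent
  vector a finitely supported map from variable indices to exponents. The ring
  \<open>k[x\<^sub>1, \<dots>, x\<^sub>n]\<close> consists of the polynomials in which only the variables
  with indices in \<open>{1..n}\<close> occur.\<close>

type_synonym 'k poly_map = "(nat \<Rightarrow>\<^sub>0 nat) \<Rightarrow>\<^sub>0 'k"

definition poly_ring :: "nat \<Rightarrow> 'k::field poly_map ring" where
  "poly_ring n =
     \<lparr>carrier = {p. \<forall>a\<in>Poly_Mapping.keys p. Poly_Mapping.keys a \<subseteq> {1..n}},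
      monoid.mult = (*), one = 1, zero = 0, add = (+)\<rparr>"

lemma cring_poly_ring: "cring (poly_ring n :: 'k::field poly_map ring)"
proof (rule cringI)
  show "abelian_group (poly_ring n :: 'k poly_map ring)"
  proof (rule abelian_groupI)
    fix x y :: "'k poly_map"
    assume "x \<in> carrier (poly_ring n)" "y \<in> carrier (poly_ring n)"
    then show "x \<oplus>\<^bsub>poly_ring n\<^esub> y \<in> carrier (poly_ring n)"
      using Poly_Mapping.keys_add[of x y] by (auto simp: poly_ring_def)
  next
    fix x :: "'k poly_map"
    assume "x \<in> carrier (poly_ring n)"
    then show "\<exists>y\<in>carrier (poly_ring n). y \<oplus>\<^bsub>poly_ring n\<^esub> x = \<zero>\<^bsub>poly_ring n\<^esub>"
      by (intro bexI[of _ "- x"]) (auto simp: poly_ring_def)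
  qed (auto simp: poly_ring_def algebra_simps)
  show "comm_monoid (poly_ring n :: 'k poly_map ring)"
  proof (rule comm_monoidI)
    fix x y :: "'k poly_map"
    assume xy: "x \<in> carrier (poly_ring n)" "y \<in> carrier (poly_ring n)"
    have "Poly_Mapping.keys c \<subseteq> {1..n}" if "c \<in> Poly_Mapping.keys (x * y)" for c
    proof -
      from that obtain a b where "c = a + b" "a \<in> Poly_Mapping.keys x" "b \<in> Poly_Mapping.keys y"
        using Poly_Mapping.keys_mult[of x y] by auto
      then show ?thesis
        using xy Poly_Mapping.keys_add[of a b] by (fastforce simp: poly_ring_def)
    qed
    then show "x \<otimes>\<^bsub>poly_ring n\<^esub> y \<in> carrier (poly_ring n)"
      by (auto simp: poly_ring_def)
  qed (auto simp: poly_ring_def algebra_simps)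
qed (auto simp: poly_ring_def algebra_simps)

definition var :: "nat \<Rightarrow> 'k::field poly_map" where
  "var i = Poly_Mapping.single (Poly_Mapping.single i 1) 1"

definition facet_monomial :: "nat set \<Rightarrow> 'k::field poly_map" where
  "facet_monomial F = (\<Prod>i\<in>F. var i)"

definition facet_ideal :: "nat \<Rightarrow> nat set set \<Rightarrow> 'k::field poly_map set" where
  "facet_ideal n \<Delta> = genideal (poly_ring n) (facet_monomial ` facets \<Delta>)"

definition monomials :: "nat \<Rightarrow> 'k::field poly_map set" where
  "monomials n = {Poly_Mapping.single a 1 | a. Poly_Mapping.keys a \<subseteq> {1..n}}"

text \<open>A greatest common divisor in the polynomial ring is unique only up to a unit; as usual for
  monomials, the one with coefficient \<open>1\<close> is taken.\<close>

definition mono_gcd :: "nat \<Rightarrow> 'k::field poly_map \<Rightarrow> 'k poly_map \<Rightarrow> 'k poly_map" where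
  "mono_gcd n p q = (THE d. d \<in> monomials n \<and> d gcdof\<^bsub>poly_ring n\<^esub> p q)"

definition exact_quotient :: "nat \<Rightarrow> 'k::field poly_map \<Rightarrow> 'k poly_map \<Rightarrow> 'k poly_map" where
  "exact_quotient n p d = (THE u. u \<in> carrier (poly_ring n) \<and> u \<otimes>\<^bsub>poly_ring n\<^esub> d = p)"

definition Res :: "nat \<Rightarrow> nat \<Rightarrow> (nat \<Rightarrow> nat set) \<Rightarrow> nat \<Rightarrow> 'k::field poly_map set" where
  "Res n r F i =
     {exact_quotient n (facet_monomial (F i)) (mono_gcd n (facet_monomial (F i)) (facet_monomial (F j)))
       | j. j \<in> {1..r} \<and> j \<noteq> i}"

end

theory Submission
  imports Defs
begin

text \<open>
  The exact quotient \<open>u\<^sub>j\<close> is the squarefree monomial of the set difference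
  \<open>F\<^sub>i - F\<^sub>j\<close> (\<open>Res_eq_facet_monomials\<close>). Hence \<open>u\<^sub>j\<close> divides \<open>u\<^sub>l\<close> iff
  \<open>F\<^sub>i \<inter> F\<^sub>l \<subseteq> F\<^sub>i \<inter> F\<^sub>j\<close>, and as \<open>r > 1\<close>, \<open>F\<^sub>i\<close> is a leaf iff some \<open>u\<^sub>j\<close>
  divides all the others.

  It remains to see that an ideal generated by a nonempty set of monomials is principal iff one
  of these monomials divides all the others (\<open>principalideal_monomials_iff\<close>). If the ideal is
  generated by a single polynomial \<open>p\<close>, then \<open>p\<close> divides a monomial and so is itself a scalar
  multiple of a monomial \<open>x\<^sup>b\<close> (\<open>times_eq_singleD\<close>). Every monomial occurring in an element of a
  monomial ideal is a multiple of one of the generators (\<open>keys_genideal_monomials\<close>), so some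
  generator divides \<open>x\<^sup>b\<close>, which in turn divides all the generators.

  That factors of monomials are monomials is also what identifies the greatest common divisor
  of two squarefree monomials as the monomial of the intersection. This property is proved by
  comparing the largest and the smallest exponent vectors of the factors in a monomial order.
\<close>

section \<open>Factors of monomials\<close>

text \<open>If \<open>(a, b)\<close> is the only pair of an exponent of \<open>p\<close> and an exponent of \<open>q\<close> that can have
  the sum \<open>a + b\<close>, then no cancellation can affect the corresponding coefficient of \<open>p * q\<close>.\<close>

lemma lookup_times_unique_sum:
  fixes p q :: "'a::monoid_add \<Rightarrow>\<^sub>0 'b::ring_1"
  assumes unique: "\<And>x y. x \<in> Poly_Mapping.keys p \<Longrightarrow> y \<in> Poly_Mapping.keys q \<Longrightarrow>
    x + y = a + b \<Longrightarrow> x = a \<and> y = b"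
  shows "Poly_Mapping.lookup (p * q) (a + b) = Poly_Mapping.lookup p a * Poly_Mapping.lookup q b"
proof -
  let ?a = "Poly_Mapping.single a (Poly_Mapping.lookup p a)"
  let ?b = "Poly_Mapping.single b (Poly_Mapping.lookup q b)"
  define p' where "p' = p - ?a"
  define q' where "q' = q - ?b"
  have keys_p': "Poly_Mapping.keys p' \<subseteq> Poly_Mapping.keys p - {a}"
    by (auto simp: p'_def in_keys_iff lookup_minus lookup_single when_def split: if_splits)
  have keys_q': "Poly_Mapping.keys q' \<subseteq> Poly_Mapping.keys q - {b}"
    by (auto simp: q'_def in_keys_iff lookup_minus lookup_single when_def split: if_splits)
  have keys_a: "Poly_Mapping.keys ?a \<subseteq> Poly_Mapping.keys p"
    by (auto simp: in_keys_iff lookup_single when_def split: if_splits)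
  have "p * q = ?a * ?b + (?a * q' + p' * q)"
    by (simp add: p'_def q'_def algebra_simps)
  moreover have "a + b \<notin> Poly_Mapping.keys (?a * q')"
  proof
    assume "a + b \<in> Poly_Mapping.keys (?a * q')"
    then obtain x y where "a + b = x + y" "x \<in> Poly_Mapping.keys ?a" "y \<in> Poly_Mapping.keys q'"
      using Poly_Mapping.keys_mult[of ?a q'] by auto
    then show False using unique[of x y] keys_a keys_q' by auto
  qed
  moreover have "a + b \<notin> Poly_Mapping.keys (p' * q)"
  proof
    assume "a + b \<in> Poly_Mapping.keys (p' * q)"
    then obtain x y where "a + b = x + y" "x \<in> Poly_Mapping.keys p'" "y \<in> Poly_Mapping.keys q"
      using Poly_Mapping.keys_mult[of p' q] by auto
    then show False using unique[of x y] keys_p' by auto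
  qed
  ultimately show ?thesis
    by (simp add: lookup_add mult_single in_keys_iff)
qed

text \<open>Over coefficients without zero divisors, the sum of the largest exponents of the factors
  occurs in the product, and so does the sum of the smallest ones. If the product has only one
  term, the two sums agree, and each factor has only one term.\<close>

lemma times_eq_singleD:
  fixes p q :: "'a::{ordered_cancel_comm_monoid_add, linorder} \<Rightarrow>\<^sub>0 'b::ring_1_no_zero_divisors"
  assumes pq: "p * q = Poly_Mapping.single c k" and "k \<noteq> 0"
  obtains a b u v where "p = Poly_Mapping.single a u" "q = Poly_Mapping.single b v"
    "u \<noteq> 0" "v \<noteq> 0" "c = a + b"
proof -
  let ?P = "Poly_Mapping.keys p" and ?Q = "Poly_Mapping.keys q"
  have "p * q \<noteq> 0"
    using assms by (metis lookup_single_eq lookup_zero)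
  then have ne: "?P \<noteq> {}" "?Q \<noteq> {}"
    by auto
  have cancel: "x = x' \<and> y = y'" if "x \<le> x'" "y \<le> y'" "x + y = x' + y'" for x x' y y' :: 'a
  proof (rule ccontr)
    assume "\<not> (x = x' \<and> y = y')"
    with that(1,2) have "x + y < x' + y'"
      by (metis add_less_le_mono add_le_less_mono order_le_less)
    with that(3) show False by simp
  qed
  have "Max ?P + Max ?Q = c"
  proof -
    have "Poly_Mapping.lookup (p * q) (Max ?P + Max ?Q) =
        Poly_Mapping.lookup p (Max ?P) * Poly_Mapping.lookup q (Max ?Q)"
    proof (rule lookup_times_unique_sum)
      fix x y assume "x \<in> ?P" "y \<in> ?Q" "x + y = Max ?P + Max ?Q"
      then show "x = Max ?P \<and> y = Max ?Q"
        using cancel[of x "Max ?P" y "Max ?Q"] by simp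
    qed
    also have "\<dots> \<noteq> 0"
      using Max_in[OF finite_keys ne(1)] Max_in[OF finite_keys ne(2)] by (simp add: in_keys_iff)
    finally show ?thesis
      by (auto simp: pq lookup_single when_def split: if_splits)
  qed
  moreover have "Min ?P + Min ?Q = c"
  proof -
    have "Poly_Mapping.lookup (p * q) (Min ?P + Min ?Q) =
        Poly_Mapping.lookup p (Min ?P) * Poly_Mapping.lookup q (Min ?Q)"
    proof (rule lookup_times_unique_sum)
      fix x y assume "x \<in> ?P" "y \<in> ?Q" "x + y = Min ?P + Min ?Q"
      then show "x = Min ?P \<and> y = Min ?Q"
        using cancel[of "Min ?P" x "Min ?Q" y] by simp
    qed
    also have "\<dots> \<noteq> 0"
      using Min_in[OF finite_keys ne(1)] Min_in[OF finite_keys ne(2)] by (simp add: in_keys_iff)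
    finally show ?thesis
      by (auto simp: pq lookup_single when_def split: if_splits)
  qed
  ultimately have eq: "Min ?P = Max ?P" "Min ?Q = Max ?Q"
    using cancel[of "Min ?P" "Max ?P" "Min ?Q" "Max ?Q"] ne by simp_all
  have single: "f = Poly_Mapping.single (Max (Poly_Mapping.keys f))
        (Poly_Mapping.lookup f (Max (Poly_Mapping.keys f)))"
    if "Min (Poly_Mapping.keys f) = Max (Poly_Mapping.keys f)" for f :: "'a \<Rightarrow>\<^sub>0 'b"
  proof (rule poly_mapping_eqI)
    fix x
    have "x = Max (Poly_Mapping.keys f)" if "x \<in> Poly_Mapping.keys f"
      using that \<open>Min (Poly_Mapping.keys f) = _\<close> Min_le[OF finite_keys that] Max_ge[OF finite_keys that]
      by (simp add: antisym)
    then show "Poly_Mapping.lookup f x = Poly_Mapping.lookup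
        (Poly_Mapping.single (Max (Poly_Mapping.keys f))
          (Poly_Mapping.lookup f (Max (Poly_Mapping.keys f)))) x"
      by (auto simp: lookup_single when_def in_keys_iff)
  qed
  have lookup_ne: "Poly_Mapping.lookup p (Max ?P) \<noteq> 0" "Poly_Mapping.lookup q (Max ?Q) \<noteq> 0"
    using Max_in[OF finite_keys ne(1)] Max_in[OF finite_keys ne(2)] by (simp_all add: in_keys_iff)
  with that single[OF eq(1)] single[OF eq(2)] lookup_ne \<open>Max ?P + Max ?Q = c\<close> show thesis
    by metis
qed

section \<open>Divisibility of monomials in the polynomial ring\<close>

text \<open>The componentwise order on exponent vectors, which describes divisibility of monomials. It
  differs from the relation \<open>\<le>\<close> on finitely supported maps, which is a lexicographic total
  order.\<close>

definition exponent_le :: "(nat \<Rightarrow>\<^sub>0 nat) \<Rightarrow> (nat \<Rightarrow>\<^sub>0 nat) \<Rightarrow> bool" where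
  "exponent_le a b \<longleftrightarrow> (\<forall>i. Poly_Mapping.lookup a i \<le> Poly_Mapping.lookup b i)"

lemma exponent_le_refl: "exponent_le a a"
  by (simp add: exponent_le_def)

lemma exponent_le_trans: "exponent_le a b \<Longrightarrow> exponent_le b c \<Longrightarrow> exponent_le a c"
  unfolding exponent_le_def using order_trans by blast

lemma exponent_le_antisym: "exponent_le a b \<Longrightarrow> exponent_le b a \<Longrightarrow> a = b"
  by (auto simp: exponent_le_def intro!: poly_mapping_eqI antisym)

lemma exponent_le_add: "exponent_le a (a + b)"
  by (simp add: exponent_le_def lookup_add)

lemma exponent_le_imp_add_diff: "exponent_le a b \<Longrightarrow> a + (b - a) = b"
  by (intro poly_mapping_eqI) (simp add: exponent_le_def lookup_add lookup_minus)

lemma carrier_poly_ring: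
  "p \<in> carrier (poly_ring n) \<longleftrightarrow> (\<forall>a\<in>Poly_Mapping.keys p. Poly_Mapping.keys a \<subseteq> {1..n})"
  by (simp add: poly_ring_def)

lemma mult_poly_ring: "p \<otimes>\<^bsub>poly_ring n\<^esub> q = p * q"
  by (simp add: poly_ring_def)

lemma single_in_carrier_poly_ring:
  "Poly_Mapping.keys a \<subseteq> {1..n} \<Longrightarrow> Poly_Mapping.single a k \<in> carrier (poly_ring n)"
  by (simp add: carrier_poly_ring)

lemma single_divides_single:
  fixes k l :: "'k::field"
  assumes "Poly_Mapping.keys b \<subseteq> {1..n}" and "k \<noteq> 0" and "exponent_le a b"
  shows "Poly_Mapping.single a k divides\<^bsub>poly_ring n\<^esub> Poly_Mapping.single b l"
proof (rule dividesI)
  have "Poly_Mapping.keys (b - a) \<subseteq> Poly_Mapping.keys b"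
    by (auto simp: in_keys_iff lookup_minus)
  with assms(1) show "Poly_Mapping.single (b - a) (l / k) \<in> carrier (poly_ring n)"
    by (intro single_in_carrier_poly_ring) auto
  show "Poly_Mapping.single b l =
      Poly_Mapping.single a k \<otimes>\<^bsub>poly_ring n\<^esub> Poly_Mapping.single (b - a) (l / k)"
    using assms(2,3) by (simp add: mult_poly_ring mult_single exponent_le_imp_add_diff)
qed

lemma divides_singleD:
  fixes p :: "'k::field poly_map"
  assumes "p divides\<^bsub>poly_ring n\<^esub> Poly_Mapping.single b k" and "k \<noteq> 0"
  obtains a u where "p = Poly_Mapping.single a u" "u \<noteq> 0" "exponent_le a b"
proof -
  from assms(1) obtain q where "p * q = Poly_Mapping.single b k"
    by (metis factor_def mult_poly_ring)
  then show thesis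
    using \<open>k \<noteq> 0\<close> by (rule times_eq_singleD) (metis that exponent_le_add)
qed

lemma single_divides_single_iff:
  fixes k l :: "'k::field"
  assumes "Poly_Mapping.keys b \<subseteq> {1..n}" and "k \<noteq> 0" and "l \<noteq> 0"
  shows "Poly_Mapping.single a k divides\<^bsub>poly_ring n\<^esub> Poly_Mapping.single b l \<longleftrightarrow> exponent_le a b"
proof
  assume "Poly_Mapping.single a k divides\<^bsub>poly_ring n\<^esub> Poly_Mapping.single b l"
  then obtain a' u where *: "Poly_Mapping.single a k = Poly_Mapping.single a' u" "u \<noteq> 0"
    and le: "exponent_le a' b"
    using \<open>l \<noteq> 0\<close> by (rule divides_singleD)
  from * \<open>k \<noteq> 0\<close> have "a = a'"
    by (metis lookup_single_eq lookup_single_not_eq)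
  with le show "exponent_le a b" by simp
qed (rule single_divides_single[OF assms(1,2)])

section \<open>Principal monomial ideals\<close>

lemma keys_genideal_monomials:
  fixes p :: "'k::field poly_map"
  assumes E: "\<And>e. e \<in> E \<Longrightarrow> Poly_Mapping.keys e \<subseteq> {1..n}"
    and p: "p \<in> genideal (poly_ring n) ((\<lambda>e. Poly_Mapping.single e 1) ` E)"
    and b: "b \<in> Poly_Mapping.keys p"
  shows "\<exists>e\<in>E. exponent_le e b"
proof -
  interpret cring "poly_ring n :: 'k poly_map ring" by (rule cring_poly_ring)
  let ?R = "poly_ring n :: 'k poly_map ring"
  define J where "J = {q \<in> carrier ?R. \<forall>b\<in>Poly_Mapping.keys q. \<exists>e\<in>E. exponent_le e b}"
  have mult: "x * q \<in> J" if "q \<in> J" "x \<in> carrier ?R" for q x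
  proof -
    have "\<exists>e\<in>E. exponent_le e b" if "b \<in> Poly_Mapping.keys (x * q)" for b
    proof -
      from that obtain c d where "b = d + c" "d \<in> Poly_Mapping.keys q"
        using Poly_Mapping.keys_mult[of x q] by (auto simp: add.commute)
      with \<open>q \<in> J\<close> show ?thesis
        unfolding J_def using exponent_le_trans exponent_le_add by blast
    qed
    moreover have "x * q \<in> carrier ?R"
      using m_closed[of x q] that by (simp add: J_def mult_poly_ring)
    ultimately show ?thesis by (simp add: J_def)
  qed
  \<comment> \<open>\<open>J\<close> is an ideal containing the generators, so it contains the ideal that they generate.\<close>
  have "ideal J ?R"
  proof (rule idealI)
    show "ring ?R" by (rule ring_axioms)
    show "subgroup J (add_monoid ?R)"
    proof (rule add.subgroupI)
      show "J \<subseteq> carrier ?R" by (auto simp: J_def)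
      have "0 \<in> J" by (simp add: J_def carrier_poly_ring)
      then show "J \<noteq> {}" by blast
      fix q assume q: "q \<in> J"
      have "q \<oplus>\<^bsub>?R\<^esub> (- q) = \<zero>\<^bsub>?R\<^esub>" "- q \<in> carrier ?R" "q \<in> carrier ?R"
        using q by (auto simp: J_def poly_ring_def)
      then have "\<ominus>\<^bsub>?R\<^esub> q = - q"
        by (metis minus_unique l_neg a_comm a_inv_closed minus_equality)
      with q show "\<ominus>\<^bsub>?R\<^esub> q \<in> J" by (auto simp: J_def poly_ring_def)
      fix q' assume q': "q' \<in> J"
      show "q \<oplus>\<^bsub>?R\<^esub> q' \<in> J"
        using q q' a_closed[of q q'] Poly_Mapping.keys_add[of q q']
        by (auto simp: J_def poly_ring_def)
    qed
  next
    fix q x assume "q \<in> J" "x \<in> carrier ?R"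
    then show "x \<otimes>\<^bsub>?R\<^esub> q \<in> J" "q \<otimes>\<^bsub>?R\<^esub> x \<in> J"
      using mult[of q x] by (simp_all add: mult_poly_ring mult.commute)
  qed
  moreover have "(\<lambda>e. Poly_Mapping.single e 1) ` E \<subseteq> J"
    using E by (auto simp: J_def single_in_carrier_poly_ring intro: exponent_le_refl)
  ultimately have "genideal ?R ((\<lambda>e. Poly_Mapping.single e 1) ` E) \<subseteq> J"
    by (rule genideal_minimal)
  with p b show ?thesis by (auto simp: J_def)
qed

text \<open>The hypothesis \<open>E \<noteq> {}\<close> is needed: the zero ideal is principal and generated by the empty
  set of monomials.\<close>

lemma principalideal_monomials_iff:
  fixes E :: "(nat \<Rightarrow>\<^sub>0 nat) set"
  assumes E: "\<And>e. e \<in> E \<Longrightarrow> Poly_Mapping.keys e \<subseteq> {1..n}" and "E \<noteq> {}"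
  shows "principalideal (genideal (poly_ring n) ((\<lambda>e. Poly_Mapping.single e 1) ` E))
      (poly_ring n :: 'k::field poly_map ring) \<longleftrightarrow> (\<exists>e\<in>E. \<forall>e'\<in>E. exponent_le e e')"
    (is "principalideal ?I ?R \<longleftrightarrow> ?min")
proof -
  interpret cring ?R by (rule cring_poly_ring)
  let ?m = "\<lambda>e. Poly_Mapping.single e 1 :: 'k poly_map"
  have carr: "?m e \<in> carrier ?R" if "e \<in> E" for e
    using E[OF that] by (rule single_in_carrier_poly_ring)
  then have sub: "?m ` E \<subseteq> carrier ?R" by blast
  show ?thesis
  proof
    assume "principalideal ?I ?R"
    then obtain p where p: "p \<in> carrier ?R" "?I = genideal ?R {p}"
      using principalideal.generate by blast
    have p_dvd: "p divides\<^bsub>?R\<^esub> ?m e" if "e \<in> E" for e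
    proof -
      have "?m e \<in> cgenideal ?R p"
        using genideal_self[OF sub] that p cgenideal_eq_genideal[OF p(1)] by auto
      then show ?thesis
        by (auto simp: cgenideal_def factor_def mult_poly_ring mult.commute)
    qed
    from \<open>E \<noteq> {}\<close> obtain e\<^sub>0 where "e\<^sub>0 \<in> E" by blast
    from p_dvd[OF this] obtain b u where b: "p = Poly_Mapping.single b u" "u \<noteq> 0"
      by (rule divides_singleD) simp
    have "p \<in> ?I"
      using genideal_self'[OF p(1)] p(2) by simp
    with b obtain e where "e \<in> E" "exponent_le e b"
      using keys_genideal_monomials[OF E, of E p b] by auto
    moreover have "exponent_le b e'" if "e' \<in> E" for e'
      using p_dvd[OF that] b E[OF that] by (simp add: single_divides_single_iff)
    ultimately show ?min
      using exponent_le_trans by blast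
  next
    assume ?min
    then obtain e where e: "e \<in> E" "\<And>e'. e' \<in> E \<Longrightarrow> exponent_le e e'" by blast
    have "?I = genideal ?R {?m e}"
    proof
      show "genideal ?R {?m e} \<subseteq> ?I"
        using genideal_self[OF sub] e(1) by (intro genideal_minimal genideal_ideal sub) auto
      have "?m e' \<in> genideal ?R {?m e}" if e': "e' \<in> E" for e'
      proof -
        have "?m e divides\<^bsub>?R\<^esub> ?m e'"
          using e(2)[OF e'] E[OF e'] by (simp add: single_divides_single_iff)
        then have "?m e' \<in> cgenideal ?R (?m e)"
          by (auto simp: cgenideal_def factor_def mult_poly_ring mult.commute)
        then show ?thesis
          by (simp add: cgenideal_eq_genideal carr[OF e(1)])
      qed
      then show "?I \<subseteq> genideal ?R {?m e}"
        using carr[OF e(1)] by (intro genideal_minimal genideal_ideal) auto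
    qed
    then show "principalideal ?I ?R"
      using carr[OF e(1)] by (intro principalidealI genideal_ideal sub) auto
  qed
qed

section \<open>Squarefree monomials\<close>

text \<open>The exponent vector of a squarefree monomial, the indicator function of a finite set of
  variable indices. On an infinite set the sum has the default value \<open>0\<close>.\<close>

definition set_exponent :: "nat set \<Rightarrow> (nat \<Rightarrow>\<^sub>0 nat)" where
  "set_exponent A = (\<Sum>i\<in>A. Poly_Mapping.single i 1)"

lemma lookup_set_exponent:
  "finite A \<Longrightarrow> Poly_Mapping.lookup (set_exponent A) i = (if i \<in> A then 1 else 0)"
  by (simp add: set_exponent_def lookup_sum lookup_single when_def)

lemma keys_set_exponent: "finite A \<Longrightarrow> Poly_Mapping.keys (set_exponent A) = A"
  by (auto simp: in_keys_iff lookup_set_exponent split: if_splits)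

lemma exponent_le_set_exponent_iff:
  "finite A \<Longrightarrow> finite B \<Longrightarrow> exponent_le (set_exponent A) (set_exponent B) \<longleftrightarrow> A \<subseteq> B"
  by (auto simp: exponent_le_def lookup_set_exponent split: if_splits)

lemma facet_monomial_eq_single:
  "finite A \<Longrightarrow> facet_monomial A = Poly_Mapping.single (set_exponent A) (1 :: 'k::field)"
  unfolding facet_monomial_def set_exponent_def var_def
  by (induction A rule: finite_induct) (simp_all add: mult_single)

lemma facet_monomial_in_carrier:
  "A \<subseteq> {1..n} \<Longrightarrow> facet_monomial A \<in> carrier (poly_ring n)"
  using finite_subset[of A "{1..n}"]
  by (simp add: facet_monomial_eq_single single_in_carrier_poly_ring keys_set_exponent)

lemma facet_monomial_gcdof:
  assumes A: "A \<subseteq> {1..n}" and B: "B \<subseteq> {1..n}"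
  shows "facet_monomial (A \<inter> B) gcdof\<^bsub>poly_ring n\<^esub> (facet_monomial A :: 'k::field poly_map)
    (facet_monomial B)"
proof -
  have fin: "finite A" "finite B" "finite (A \<inter> B)"
    using A B by (simp_all add: finite_subset)
  have meet: "exponent_le a (set_exponent (A \<inter> B))"
    if "exponent_le a (set_exponent A)" "exponent_le a (set_exponent B)" for a
    unfolding exponent_le_def
  proof
    fix i
    show "Poly_Mapping.lookup a i \<le> Poly_Mapping.lookup (set_exponent (A \<inter> B)) i"
      using that[unfolded exponent_le_def, THEN spec, of i] fin
      by (auto simp: lookup_set_exponent split: if_splits)
  qed
  have keys: "Poly_Mapping.keys (set_exponent C) \<subseteq> {1..n}" if "C \<in> {A, B, A \<inter> B}" for C
    using that A B fin by (auto simp only: keys_set_exponent)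
  have "y divides\<^bsub>poly_ring n\<^esub> facet_monomial (A \<inter> B)"
    if y: "y divides\<^bsub>poly_ring n\<^esub> facet_monomial A" "y divides\<^bsub>poly_ring n\<^esub> facet_monomial B"
    for y :: "'k poly_map"
  proof -
    obtain a u where "y = Poly_Mapping.single a u" "u \<noteq> 0"
      using y(1) unfolding facet_monomial_eq_single[OF fin(1)] by (rule divides_singleD) simp
    then show ?thesis
      using y fin keys meet
      by (simp add: facet_monomial_eq_single single_divides_single_iff)
  qed
  with A B fin show ?thesis
    by (auto simp: isgcd_def facet_monomial_eq_single single_divides_single_iff keys_set_exponent
        exponent_le_set_exponent_iff)
qed

text \<open>The description of \<open>mono_gcd\<close> is well defined since two monomials with coefficient \<open>1\<close>
  that divide each other are equal.\<close>

lemma mono_gcd_facet_monomial: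
  assumes A: "A \<subseteq> {1..n}" and B: "B \<subseteq> {1..n}"
  shows "mono_gcd n (facet_monomial A) (facet_monomial B) =
    (facet_monomial (A \<inter> B) :: 'k::field poly_map)"
  unfolding mono_gcd_def
proof (rule the_equality)
  have fin: "finite (A \<inter> B)" using A by (simp add: finite_subset)
  show *: "(facet_monomial (A \<inter> B) :: 'k poly_map) \<in> monomials n \<and>
      facet_monomial (A \<inter> B) gcdof\<^bsub>poly_ring n\<^esub> (facet_monomial A :: 'k poly_map) (facet_monomial B)"
  proof
    have "Poly_Mapping.keys (set_exponent (A \<inter> B)) \<subseteq> {1..n}"
      using A fin by (simp add: keys_set_exponent le_infI1)
    then show "(facet_monomial (A \<inter> B) :: 'k poly_map) \<in> monomials n"
      unfolding monomials_def facet_monomial_eq_single[OF fin] by blast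
  qed (rule facet_monomial_gcdof[OF A B])
  fix d :: "'k poly_map"
  assume d: "d \<in> monomials n \<and> d gcdof\<^bsub>poly_ring n\<^esub> (facet_monomial A) (facet_monomial B)"
  then obtain a where a: "d = Poly_Mapping.single a 1" "Poly_Mapping.keys a \<subseteq> {1..n}"
    by (auto simp: monomials_def)
  have "facet_monomial (A \<inter> B) divides\<^bsub>poly_ring n\<^esub> d"
    using d * A by (simp add: isgcd_def facet_monomial_in_carrier le_infI1)
  moreover have "d divides\<^bsub>poly_ring n\<^esub> facet_monomial (A \<inter> B)"
    using d * a by (simp add: isgcd_def single_in_carrier_poly_ring)
  ultimately have "a = set_exponent (A \<inter> B)"
    using a A by (intro exponent_le_antisym) (simp_all add: facet_monomial_eq_single[OF fin]
        single_divides_single_iff keys_set_exponent[OF fin] le_infI1)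
  then show "d = facet_monomial (A \<inter> B)"
    by (simp add: a facet_monomial_eq_single[OF fin])
qed

lemma facet_monomial_Un_disjoint:
  "finite A \<Longrightarrow> finite B \<Longrightarrow> A \<inter> B = {} \<Longrightarrow>
    facet_monomial (A \<union> B) = facet_monomial A * facet_monomial B"
  by (simp add: facet_monomial_def prod.union_disjoint)

lemma exact_quotient_facet_monomial:
  assumes A: "A \<subseteq> {1..n}"
  shows "exact_quotient n (facet_monomial A) (facet_monomial (A \<inter> B)) =
    (facet_monomial (A - B) :: 'k::field poly_map)"
  unfolding exact_quotient_def
proof (rule the_equality)
  have fin: "finite A" using A by (simp add: finite_subset)
  have eq: "(facet_monomial (A - B) :: 'k poly_map) * facet_monomial (A \<inter> B) = facet_monomial A"
  proof -
    have "facet_monomial (A - B) * facet_monomial (A \<inter> B) =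
        (facet_monomial (A - B \<union> A \<inter> B) :: 'k poly_map)"
      using fin by (intro facet_monomial_Un_disjoint[symmetric]) auto
    then show ?thesis by (simp only: Un_Diff_Int)
  qed
  then show "(facet_monomial (A - B) :: 'k poly_map) \<in> carrier (poly_ring n) \<and>
      facet_monomial (A - B) \<otimes>\<^bsub>poly_ring n\<^esub> facet_monomial (A \<inter> B) =
      (facet_monomial A :: 'k poly_map)"
    using A by (simp add: mult_poly_ring facet_monomial_in_carrier subset_trans[OF Diff_subset])
  have nz: "(facet_monomial (A \<inter> B) :: 'k poly_map) \<noteq> 0"
    using fin by (metis facet_monomial_eq_single finite_Int lookup_single_eq lookup_zero zero_neq_one)
  fix u :: "'k poly_map"
  assume "u \<in> carrier (poly_ring n) \<and>
    u \<otimes>\<^bsub>poly_ring n\<^esub> facet_monomial (A \<inter> B) = facet_monomial A"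
  then have "u * facet_monomial (A \<inter> B) = facet_monomial (A - B) * facet_monomial (A \<inter> B)"
    by (simp add: mult_poly_ring eq)
  with nz show "u = facet_monomial (A - B)" by simp
qed

lemma Res_eq_facet_monomials:
  assumes "\<And>j. j \<in> {1..r} \<Longrightarrow> F j \<subseteq> {1..n}" and "i \<in> {1..r}"
  shows "Res n r F i = (\<lambda>j. facet_monomial (F i - F j) :: 'k::field poly_map) ` ({1..r} - {i})"
proof -
  let ?u = "\<lambda>j. exact_quotient n (facet_monomial (F i))
    (mono_gcd n (facet_monomial (F i)) (facet_monomial (F j))) :: 'k poly_map"
  have "?u j = facet_monomial (F i - F j)" if "j \<in> {1..r}" for j
    using assms that by (simp add: mono_gcd_facet_monomial exact_quotient_facet_monomial)
  then have "?u ` ({1..r} - {i}) =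
      (\<lambda>j. facet_monomial (F i - F j) :: 'k poly_map) ` ({1..r} - {i})"
    by (intro image_cong) simp_all
  moreover have "{j. j \<in> {1..r} \<and> j \<noteq> i} = {1..r} - {i}"
    by blast
  moreover have "Res n r F i = ?u ` {j. j \<in> {1..r} \<and> j \<noteq> i}"
    unfolding Res_def by (rule setcompr_eq_image)
  ultimately show ?thesis
    by (simp only:)
qed

section \<open>Leaves and principal residual ideals\<close>

text \<open>Taking the difference from \<open>F i\<close> reverses inclusions between intersections with \<open>F i\<close>, so
  the largest intersection in the definition of a leaf becomes a least difference.\<close>

lemma leaf_iff_least_difference:
  fixes F :: "nat \<Rightarrow> nat set" and i r :: nat
  assumes bij: "bij_betw F {1..r} (facets \<Delta>)" and "r > 1" and i: "i \<in> {1..r}"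
  shows "leaf \<Delta> (F i) \<longleftrightarrow> (\<exists>j\<in>{1..r} - {i}. \<forall>l\<in>{1..r} - {i}. F i - F j \<subseteq> F i - F l)"
proof -
  have img: "facets \<Delta> = F ` {1..r}" and inj: "inj_on F {1..r}"
    using bij by (simp_all add: bij_betw_def)
  have others: "facets \<Delta> - {F i} = F ` ({1..r} - {i})"
    using inj_on_image_set_diff[OF inj, of "{1..r}" "{i}"] img i by simp
  \<comment> \<open>As \<open>r > 1\<close>, there is a second facet, which excludes the case of a leaf that is the only facet.\<close>
  have "(if i = 1 then 2 else 1) \<in> {1..r} - {i}"
    using \<open>r > 1\<close> i by auto
  then have "facets \<Delta> - {F i} \<noteq> {}"
    unfolding others by blast
  then have "facets \<Delta> \<noteq> {F i}"
    by blast
  moreover have "F i \<in> facets \<Delta>"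
    using img i by simp
  ultimately have "leaf \<Delta> (F i) \<longleftrightarrow>
      (\<exists>G\<in>facets \<Delta> - {F i}. \<forall>F'\<in>facets \<Delta> - {F i}. F i \<inter> F' \<subseteq> F i \<inter> G)"
    by (simp add: leaf_def Bex_def Ball_def imp_conjL)
  also have "\<dots> \<longleftrightarrow> (\<exists>j\<in>{1..r} - {i}. \<forall>l\<in>{1..r} - {i}. F i \<inter> F l \<subseteq> F i \<inter> F j)"
    by (simp add: others)
  also have "\<dots> \<longleftrightarrow> (\<exists>j\<in>{1..r} - {i}. \<forall>l\<in>{1..r} - {i}. F i - F j \<subseteq> F i - F l)"
  proof -
    have "F i \<inter> F l \<subseteq> F i \<inter> F j \<longleftrightarrow> F i - F j \<subseteq> F i - F l" for j l by blast
    then show ?thesis by simp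
  qed
  finally show ?thesis .
qed

theorem theorem3p6:
  fixes n r i :: nat
    and \<Delta> :: "nat set set"
    and F :: "nat \<Rightarrow> nat set"
    and I :: "'k::field poly_map set"
  assumes "infinite (UNIV :: 'k set)"
    and "simplicial_complex n \<Delta>"
    and "bij_betw F {1..r} (facets \<Delta>)"
    and "r > 1"
    and "I = facet_ideal n \<Delta>"
    and "i \<in> {1..r}"
  shows "leaf \<Delta> (F i) \<longleftrightarrow>
    principalideal (genideal (poly_ring n) (Res n r F i :: 'k poly_map set)) (poly_ring n)"
proof -
  have F: "F j \<subseteq> {1..n}" if "j \<in> {1..r}" for j
  proof -
    have "F j \<in> \<Delta>"
      using bij_betwE[OF assms(3)] that by (simp add: facets_def)
    with assms(2) show ?thesis by (auto simp only: simplicial_complex_def)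
  qed
  let ?J = "{1..r} - {i}"
  let ?E = "(\<lambda>j. set_exponent (F i - F j)) ` ?J"
  have fin: "finite (F i - F j)" for j
    using F[OF assms(6)] by (meson finite_Diff finite_subset finite_atLeastAtMost)
  have "(if i = 1 then 2 else 1) \<in> ?J"
    using \<open>r > 1\<close> assms(6) by auto
  then have "?E \<noteq> {}" by blast
  have E: "Poly_Mapping.keys e \<subseteq> {1..n}" if "e \<in> ?E" for e
    using that F[OF assms(6)] fin by (auto simp: keys_set_exponent)
  have "Res n r F i = (\<lambda>j. facet_monomial (F i - F j) :: 'k poly_map) ` ?J"
    using F assms(6) by (rule Res_eq_facet_monomials)
  also have "\<dots> = (\<lambda>e. Poly_Mapping.single e 1) ` ?E"
    by (simp add: facet_monomial_eq_single fin image_image)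
  finally have "principalideal (genideal (poly_ring n) (Res n r F i :: 'k poly_map set)) (poly_ring n)
      \<longleftrightarrow> (\<exists>e\<in>?E. \<forall>e'\<in>?E. exponent_le e e')"
    using principalideal_monomials_iff[OF E \<open>?E \<noteq> {}\<close>] by simp
  also have "\<dots> \<longleftrightarrow> (\<exists>j\<in>?J. \<forall>l\<in>?J. F i - F j \<subseteq> F i - F l)"
    by (simp only: ball_simps(9) bex_simps(7) exponent_le_set_exponent_iff[OF fin fin])
  also have "\<dots> \<longleftrightarrow> leaf \<Delta> (F i)"
    by (rule leaf_iff_least_difference[OF assms(3,4,6), symmetric])
  finally show ?thesis by simp
qed

end
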